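(* Let $\epsilon,s\in(0,1)$ with $\epsilon<\frac{1-s}{2s}$, and let $$R=\begin{pmatrix}-1&\epsilon\\-\epsilon&0\end{pmatrix},\qquad S=\begin{pmatrix}s&s\\1&1\end{pmatrix}.$$ Consider the ratio game with value $V(x,y)=\frac{\langle x,Ry\rangle}{\langle x,Sy\rangle}$ for $x,y$ in the probability simplex $\Delta\subset\mathbb R^2$, where $x$ is chosen by the min-player and $y$ by the max-player. Then: (1) the game has a unique Nash equilibrium $z^\star=(x^\star,y^\star)$, given by $x^\star=y^\star=(0,1)$; (2) the stopping probability satisfies $\langle x,Sy\rangle\ge s$ for all $x,y\in\Delta$ (i.e. $\zeta\ge s$); (3) there exists $z=(x,y)\in\Delta\times\Delta$ such that $\langle F(z),z-z^\star\rangle<0$, where $F(z)=(\nabla_xV(x,y),-\nabla_yV(x,y))$.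
   Context: A Nash equilibrium is a pair $(x^\star,y^\star)\in\Delta\times\Delta$ with $V(x^\star,y)\le V(x^\star,y^\star)\le V(x,y^\star)$ for all $x,y\in\Delta$. The ratio game is the value of a single-state stochastic game in which $R_{a,b}$ is the immediate reward and $S_{a,b}$ the stopping probability for the action pair $(a,b)$; $\zeta$ denotes a lower bound on $\langle x,Sy\rangle$ over $x,y\in\Delta$. Gradients are those of the formula $\langle x,Ry\rangle/\langle x,Sy\rangle$ viewed as a function on a neighborhood of $\Delta\times\Delta$ in $\mathbb R^2\times\mathbb R^2$. *)

theory Defs
  imports "HOL-Analysis.Analysis"
begin

definition prob_simplex :: "(real ^ 'n) set" where
  "prob_simplex = {x. (\<forall>i. 0 \<le> x $ i) \<and> (\<Sum>i\<in>UNIV. x $ i) = 1}"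

(* Total on the ambient space, with value 0 where the denominator vanishes. *)
definition ratio_value ::
  "real ^ 'n ^ 'm \<Rightarrow> real ^ 'n ^ 'm \<Rightarrow> real ^ 'm \<Rightarrow> real ^ 'n \<Rightarrow> real" where
  "ratio_value R S x y = (x \<bullet> (R *v y)) / (x \<bullet> (S *v y))"

(* The first component is chosen by the min-player, the second by the max-player. *)
definition nash_equilibrium ::
  "(real ^ 'm \<Rightarrow> real ^ 'n \<Rightarrow> real) \<Rightarrow> (real ^ 'm) \<times> (real ^ 'n) \<Rightarrow> bool" where
  "nash_equilibrium V z \<longleftrightarrow>
     z \<in> prob_simplex \<times> prob_simplex \<and>
     (\<forall>x\<in>prob_simplex. \<forall>y\<in>prob_simplex.
        V (fst z) y \<le> V (fst z) (snd z) \<and> V (fst z) (snd z) \<le> V x (snd z))"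

(* Unspecified where f is not differentiable. *)
definition grad :: "('a::real_inner \<Rightarrow> real) \<Rightarrow> 'a \<Rightarrow> 'a" where
  "grad f x = (THE D. GDERIV f x :> D)"

lemma grad_eqI:
  assumes "GDERIV f x :> D"
  shows "grad f x = D"
  unfolding grad_def
proof (rule the_equality)
  show "GDERIV f x :> D" by fact
next
  fix D' assume "GDERIV f x :> D'"
  with assms have "(\<lambda>h. h \<bullet> D') = (\<lambda>h. h \<bullet> D)"
    unfolding gderiv_def by (rule has_derivative_unique[rotated])
  then show "D' = D"
    by (metis vector_eq_ldot)
qed

(* The partial gradients are taken in the ambient spaces, not along the simplex. *)
definition game_operator ::
  "(real ^ 'm \<Rightarrow> real ^ 'n \<Rightarrow> real) \<Rightarrow> (real ^ 'm) \<times> (real ^ 'n) \<Rightarrow> (real ^ 'm) \<times> (real ^ 'n)" where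
  "game_operator V z =
     (grad (\<lambda>x. V x (snd z)) (fst z), - grad (\<lambda>y. V (fst z) y) (snd z))"

end

theory Submission
  imports Defs
begin

text \<open>Let \<open>z = (x, y)\<close> be an equilibrium. Playing \<open>x\<^sup>\<star>\<close> and
\<open>y\<^sup>\<star>\<close> against it gives \<open>V(x, y\<^sup>\<star>) \<le> V(x, y) \<le> V(x\<^sup>\<star>, y)\<close>, while
\<open>V(x, y\<^sup>\<star>) = \<epsilon> x\<^sub>1 / \<langle>x, S y\<^sup>\<star>\<rangle> \<ge> 0\<close> and \<open>V(x\<^sup>\<star>, y) = - \<epsilon> y\<^sub>1 \<le> 0\<close>; this forces
\<open>x\<^sub>1 = y\<^sub>1 = 0\<close>. The monotonicity condition fails at \<open>x = y = (1, 0)\<close>, where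
\<open>\<langle>F(z), z - z\<^sup>\<star>\<rangle> = (2 \<epsilon> s - (1 - s)) / s\<^sup>2\<close>.\<close>

text \<open>Quotient rule for two linear functionals. With one strategy fixed, the ratio has this
  form in the other, so both partial gradients come from here.\<close>

lemma GDERIV_inner_divide:
  fixes a b x :: "'a::real_inner"
  assumes "x \<bullet> b \<noteq> 0"
  shows "GDERIV (\<lambda>x. (x \<bullet> a) / (x \<bullet> b)) x :>
           (1 / (x \<bullet> b)) *\<^sub>R a - ((x \<bullet> a) / (x \<bullet> b)\<^sup>2) *\<^sub>R b"
  unfolding gderiv_def using assms
  by (auto intro!: derivative_eq_intros
      simp: fun_eq_iff inner_diff_right field_simps power2_eq_square)

lemma grad_ratio_value_left:
  assumes "x \<bullet> (S *v y) \<noteq> 0"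
  shows "grad (\<lambda>x. ratio_value R S x y) x =
           (1 / (x \<bullet> (S *v y))) *\<^sub>R (R *v y)
             - ((x \<bullet> (R *v y)) / (x \<bullet> (S *v y))\<^sup>2) *\<^sub>R (S *v y)"
  unfolding ratio_value_def by (intro grad_eqI GDERIV_inner_divide assms)

lemma grad_ratio_value_right:
  fixes x :: "real ^ 'm" and y :: "real ^ 'n"
  assumes "x \<bullet> (S *v y) \<noteq> 0"
  shows "grad (\<lambda>y. ratio_value R S x y) y =
           (1 / (x \<bullet> (S *v y))) *\<^sub>R (x v* R)
             - ((x \<bullet> (R *v y)) / (x \<bullet> (S *v y))\<^sup>2) *\<^sub>R (x v* S)"
proof -
  \<comment> \<open>Transposing moves the variable \<open>y\<close> into the left slot, where the
    quotient rule applies.\<close>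
  have swap: "x \<bullet> (A *v v) = v \<bullet> (x v* A)" for A :: "real ^ 'n ^ 'm" and v
    by (metis dot_lmul_matrix inner_commute)
  show ?thesis
    unfolding ratio_value_def swap
    by (intro grad_eqI GDERIV_inner_divide) (use assms in \<open>simp flip: swap\<close>)
qed

lemma prob_simplex_2:
  "x \<in> prob_simplex \<longleftrightarrow> 0 \<le> x $ 1 \<and> 0 \<le> x $ 2 \<and> x $ 1 + x $ 2 = 1"
  for x :: "real ^ 2"
  by (auto simp: prob_simplex_def forall_2 sum_2)

lemma inner_matrix_vector_mult_2:
  fixes A :: "real ^ 2 ^ 2"
  shows "x \<bullet> (A *v y) =
    x $ 1 * (A $ 1 $ 1 * y $ 1 + A $ 1 $ 2 * y $ 2) +
    x $ 2 * (A $ 2 $ 1 * y $ 1 + A $ 2 $ 2 * y $ 2)"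
  by (simp add: inner_vec_def sum_2 matrix_vector_mult_def)

theorem proposition2:
  fixes \<epsilon> s :: real
    and R S :: "real ^ 2 ^ 2"
    and zstar :: "(real ^ 2) \<times> (real ^ 2)"
  assumes "0 < \<epsilon>" and "\<epsilon> < 1"
    and "0 < s" and "s < 1"
    and "\<epsilon> < (1 - s) / (2 * s)"
    and "R = vector [vector [- 1, \<epsilon>], vector [- \<epsilon>, 0]]"
    and "S = vector [vector [s, s], vector [1, 1]]"
    and "zstar = (vector [0, 1], vector [0, 1])"
  shows "(\<forall>z. nash_equilibrium (ratio_value R S) z \<longleftrightarrow> z = zstar) \<and>
         (\<forall>x\<in>prob_simplex. \<forall>y\<in>prob_simplex. s \<le> x \<bullet> (S *v y)) \<and>
         (\<exists>z\<in>prob_simplex \<times> prob_simplex.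
            game_operator (ratio_value R S) z \<bullet> (z - zstar) < 0)"
proof -
  note eps = \<open>0 < \<epsilon>\<close> and s = \<open>0 < s\<close> \<open>s < 1\<close>
  note R = \<open>R = _\<close> and S = \<open>S = _\<close> and zstar = \<open>zstar = _\<close>
  let ?V = "ratio_value R S"
  let ?e = "vector [0, 1] :: real ^ 2"
  have e: "?e \<in> prob_simplex"
    by (simp add: prob_simplex_2)
  have inner_R: "x \<bullet> (R *v y) = x $ 1 * (\<epsilon> * y $ 2 - y $ 1) - \<epsilon> * x $ 2 * y $ 1" for x y
    by (simp add: inner_matrix_vector_mult_2 R algebra_simps)
  \<comment> \<open>The rows of \<open>S\<close> are constant, so \<open>y\<close> enters only
    through its total mass 1.\<close>
  have inner_S: "x \<bullet> (S *v y) = s * x $ 1 + x $ 2" if "y \<in> prob_simplex" for x y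
  proof -
    have "x \<bullet> (S *v y) = (s * x $ 1 + x $ 2) * (y $ 1 + y $ 2)"
      by (simp add: inner_matrix_vector_mult_2 S algebra_simps)
    with that show ?thesis
      by (simp add: prob_simplex_2)
  qed
  \<comment> \<open>This is a convex combination of \<open>s\<close> and 1, and
    \<open>s < 1\<close>.\<close>
  have stop_ge: "s \<le> s * x $ 1 + x $ 2" if "x \<in> prob_simplex" for x :: "real ^ 2"
  proof -
    have "s * x $ 2 \<le> x $ 2"
      using that s by (simp add: prob_simplex_2 mult_left_le_one_le)
    moreover have "s * x $ 1 + s * x $ 2 = s"
      using that by (simp add: prob_simplex_2 flip: distrib_left)
    ultimately show ?thesis by linarith
  qed
  have V_left: "?V ?e y = - \<epsilon> * y $ 1" if "y \<in> prob_simplex" for y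
    using that by (simp add: ratio_value_def inner_R inner_S)
  have V_right: "?V x ?e = \<epsilon> * x $ 1 / (s * x $ 1 + x $ 2)" for x
    by (simp add: ratio_value_def inner_R inner_S[OF e])
  have V_left_le: "?V ?e y \<le> 0" if "y \<in> prob_simplex" for y
    using that eps by (simp add: V_left prob_simplex_2)
  have V_right_ge: "0 \<le> ?V x ?e" if "x \<in> prob_simplex" for x
    using that eps s stop_ge[OF that] by (simp add: V_right prob_simplex_2)
  have V_e: "?V ?e ?e = 0"
    by (simp add: V_left[OF e])

  have equilibrium: "nash_equilibrium ?V zstar"
    using e V_left_le V_right_ge by (simp add: nash_equilibrium_def zstar V_e)
  have unique: "z = zstar" if "nash_equilibrium ?V z" for z
  proof -
    obtain x y where z: "z = (x, y)" by force
    have x: "x \<in> prob_simplex" and y: "y \<in> prob_simplex"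
      and "?V x ?e \<le> ?V x y" "?V x y \<le> ?V ?e y"
      using that e by (auto simp: nash_equilibrium_def z)
    then have "?V x ?e = 0" "?V ?e y = 0"
      using V_left_le[OF y] V_right_ge[OF x] by linarith+
    \<comment> \<open>By \<open>stop_ge\<close> the denominator in \<open>V_right\<close> is
      positive, so the value 0 comes from the numerator and not from the convention for division by
      zero.\<close>
    then have "x $ 1 = 0" "y $ 1 = 0"
      using eps s stop_ge[OF x] by (auto simp: V_left[OF y] V_right)
    with x y show ?thesis
      by (simp add: z zstar prob_simplex_2 vec_eq_iff forall_2)
  qed

  let ?a = "vector [1, 0] :: real ^ 2"
  have a: "?a \<in> prob_simplex"
    by (simp add: prob_simplex_2)
  have Ra: "?a \<bullet> (R *v ?a) = - 1" and Sa: "?a \<bullet> (S *v ?a) = s"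
    by (simp_all add: inner_R inner_S[OF a])
  \<comment> \<open>The ratio is homogeneous of degree 0 in each argument, so by Euler's identity
    both partial gradients are orthogonal to \<open>?a\<close>; hence the zero first entries here
    and in \<open>grad_y\<close>.\<close>
  have grad_x: "grad (\<lambda>x. ?V x ?a) ?a = vector [0, 1 / s\<^sup>2 - \<epsilon> / s]"
    using s Ra Sa
    by (simp add: grad_ratio_value_left vec_eq_iff forall_2 matrix_vector_mult_def sum_2 R S
        power2_eq_square)
  have grad_y: "grad (\<lambda>y. ?V ?a y) ?a = vector [0, (1 + \<epsilon>) / s]"
    using s Ra Sa
    by (simp add: grad_ratio_value_right vec_eq_iff forall_2 vector_matrix_mult_def sum_2 R S
        power2_eq_square add_divide_distrib)
  \<comment> \<open>Both components of the difference are \<open>(1, -1)\<close>, so only the second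
    entries of the gradients count, with sign reversed.\<close>
  have "game_operator ?V (?a, ?a) \<bullet> ((?a, ?a) - zstar) = (1 + \<epsilon>) / s - (1 / s\<^sup>2 - \<epsilon> / s)"
    by (simp add: game_operator_def grad_x grad_y zstar inner_prod_def inner_vec_def sum_2)
  also have "\<dots> = (2 * \<epsilon> * s - (1 - s)) / s\<^sup>2"
    using s by (simp add: field_simps power2_eq_square)
  \<comment> \<open>Negativity of the numerator is exactly the upper bound assumed on
    \<open>\<epsilon>\<close>.\<close>
  also have "\<dots> < 0"
    using \<open>\<epsilon> < (1 - s) / (2 * s)\<close> s by (simp add: field_simps)
  finally have "\<exists>z\<in>prob_simplex \<times> prob_simplex. game_operator ?V z \<bullet> (z - zstar) < 0"
    using a by blast
  moreover have "\<forall>x\<in>prob_simplex. \<forall>y\<in>prob_simplex. s \<le> x \<bullet> (S *v y)"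
    using inner_S stop_ge by metis
  moreover have "\<forall>z. nash_equilibrium ?V z \<longleftrightarrow> z = zstar"
    using equilibrium unique by metis
  ultimately show ?thesis by (intro conjI)
qed

end
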